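(* Let $\mathbb{S}_1\subseteq\mathbb{R}^{m\times n}$ and $\mathbb{S}_2\subseteq\mathbb{R}^m$ be linear subspaces of structured matrices and vectors with structure matrices $\Phi_{\mathbb{S}_1}\in\mathbb{R}^{mn\times k_1}$ and $\Phi_{\mathbb{S}_2}\in\mathbb{R}^{m\times k_2}$ (see context), $m\ge n$. Let $A\in\mathbb{S}_1$, $b\in\mathbb{S}_2$ with $\mathrm{vec}(A)=\Phi_{\mathbb{S}_1}s_1$ and $b=\Phi_{\mathbb{S}_2}s_2$, let $J=\mathrm{diag}(I_p,-I_q)$ with $p+q=m$, and assume $M=A^TJA$ is positive definite. Let $x=x(A,b)=M^{-1}A^TJb$, $r=b-Ax$, let $L\in\mathbb{R}^{n\times k}$ ($k\le n$) be fixed, and set $$M_{g'}=\left[\left((Jr)^T\otimes(L^TM^{-1})\right)\Pi_{mn}-x^T\otimes(L^TM^{-1}A^TJ),\ \ L^TM^{-1}A^TJ\right].$$ Let $\Psi\in\mathbb{S}_1$, $\beta\in\mathbb{S}_2$ with $\mathrm{vec}(\Psi)=\Phi_{\mathbb{S}_1}\varphi$, $\beta=\Phi_{\mathbb{S}_2}\theta$, and $\xi\in\mathbb{R}^k$. Then the structured partial condition number under the $\infty$-norm of the indefinite least squares problem with respect to $L$ (defined in the context) is $$\kappa^S_{\infty ILS}(A,b)=\left\|\mathrm{diag}^{\ddag}(\xi)M_{g'}\begin{bmatrix}\Phi_{\mathbb{S}_1}&0\\ 0&\Phi_{\mathbb{S}_2}\end{bmatrix}\mathrm{diag}(\mathrm{vec}(\varphi,\theta))\right\|_\infty=\left\|\frac{\left|M_{g'}\begin{bmatrix}\Phi_{\mathbb{S}_1}&0\\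 0&\Phi_{\mathbb{S}_2}\end{bmatrix}\right|\left|\begin{bmatrix}\varphi\\ \theta\end{bmatrix}\right|}{|\xi|}\right\|_\infty .$$ In particular, for $\Psi=A$, $\beta=b$ (i.e. $\varphi=s_1$, $\theta=s_2$) and $\xi=\left[\|L^Tx(A,b)\|_\infty,\dots,\|L^Tx(A,b)\|_\infty\right]^T$ one obtains the structured partial mixed condition number $$\kappa^S_{mILS}(A,b)=\frac{\left\|\left|M_{g'}\begin{bmatrix}\Phi_{\mathbb{S}_1}&0\\ 0&\Phi_{\mathbb{S}_2}\end{bmatrix}\right|\left|\begin{bmatrix}s_1\\ s_2\end{bmatrix}\right|\right\|_\infty}{\|L^Tx(A,b)\|_\infty},$$ and for $\Psi=A$, $\beta=b$ and $\xi=L^Tx(A,b)$ the structured partial componentwise condition number $$\kappa^S_{cILS}(A,b)=\left\|\frac{\left|M_{g'}\begin{bmatrix}\Phi_{\mathbb{S}_1}&0\\ 0&\Phi_{\mathbb{S}_2}\end{bmatrix}\right|\left|\begin{bmatrix}s_1\\ s_2\end{bmatrix}\right|}{|L^Tx(A,b)|}\right\|_\infty .$$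
   Context: The indefinite least squares (ILS) problem is $\min_{x\in\mathbb{R}^n}(b-Ax)^TJ(b-Ax)$; when $A^TJA$ is positive definite its unique solution is $x(A,b)=M^{-1}A^TJb$. Notation: for $c\in\mathbb{R}$, $c^{\ddag}=1/c$ if $c\neq 0$ and $c^{\ddag}=1$ if $c=0$. For a vector $v$, $\mathrm{diag}(v)$ is the diagonal matrix with diagonal $v$, and $\mathrm{diag}^{\ddag}(v)$ the diagonal matrix with diagonal entries $v_i^{\ddag}$. All divisions between vectors (including scalars) are entry-wise with the convention $\frac{a}{v}=\mathrm{diag}^{\ddag}(v)a$, and similarly for matrices of equal size. $|\cdot|$ applied to a matrix or vector is the entry-wise absolute value. $\|\cdot\|_\infty$ is the max norm of a vector and the induced (max row sum) norm of a matrix. $\mathrm{vec}$ stacks the columns of a matrix; $\mathrm{vec}(\varphi,\theta)$ is $\varphi$ stacked on top of $\theta$ (same convention for other pairs, a matrix in a pair being first vectorized). $\otimes$ is the Kronecker product; $\Pi_{mn}$ is the vec-permutation matrix with $\Pi_{mn}\mathrm{vec}(X)=\mathrm{vec}(X^T)$ for all $X\in\mathbb{R}^{m\times n}$. Structures: $\mathbb{S}_1$ (e.g. symmetric, Toeplitz or Hankel matrices) and $\mathbb{S}_2$ are described by fixed structure matrices: $X\in\mathbb{S}_1$ iff $\mathrm{vec}(X)=\Phi_{\mathbb{S}_1}s$ for some vector $s\in\mathbb{R}^{k_1}$ of independent parameters, and $y\in\mathbb{S}_2$ iff $y=\Phi_{\mathbb{S}_2}s$ for some vector $s\in\mathbb{R}^{k_2}$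 of independent parameters. Each structure matrix $\Phi$ has the properties: its columns are nonzero and mutually orthogonal; $\frac{\Phi s}{\Phi\varphi}=\Phi\frac{s}{\varphi}$ for all $s,\varphi$ such that $s_j=0$ whenever $\varphi_j=0$; and $\|\Phi y\|_\infty=\|y\|_\infty$ for all $y$ (as holds for $0$-$1$ matrices with at most one $1$ in each row and no zero column). Let $g(A,b)=L^Tx(A,b)$, with Fréchet derivative (as a map on all of $\mathbb{R}^{m\times n}\times\mathbb{R}^m$) $$g'(A,b)\circ(\Delta A,\Delta b)=L^TM^{-1}(\Delta A)^TJr-L^TM^{-1}A^TJ(\Delta A)x+L^TM^{-1}A^TJ\,\Delta b .$$ The structured partial condition number under the $\infty$-norm is $$\kappa^S_{\infty ILS}(A,b)=\sup\frac{\left\|\frac{g'(A,b)\circ(\Delta A,\Delta b)}{\xi}\right\|_\infty}{\left\|\mathrm{vec}\left(\frac{\Delta A}{\Psi},\frac{\Delta b}{\beta}\right)\right\|_\infty},$$ the supremum being over $\Delta A\in\mathbb{S}_1$, $\Delta b\in\mathbb{S}_2$ with $\left\|\mathrm{vec}\left(\frac{\Delta A}{\Psi},\frac{\Delta b}{\beta}\right)\right\|_\infty\ne0$, with the requirement that if some entry of $\Psi$ or $\beta$ is zero, the corresponding entry of $\Delta A$ or $\Delta b$ is zero. The structured mixed and componentwise condition numbers $\kappa^S_{mILS}$, $\kappa^S_{cILS}$ are by definition the values of $\kappa^S_{\infty ILS}$ for the two indicated choices of $\Psi,\beta,\xi$. *)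

theory Defs
  imports "HOL-Analysis.Analysis"
begin

section \<open>Entrywise operations, stacking and Kronecker products\<close>

text \<open>A scalar \<open>c\<close> is divided by \<open>d\<close> as \<open>ddag d * c\<close>; in particular dividing by
  zero leaves the numerator unchanged (unlike \<open>x / 0 = 0\<close> of the library).\<close>

definition ddag :: "real \<Rightarrow> real" where
  "ddag c = (if c = 0 then 1 else 1 / c)"

definition diag_mat :: "real^'n \<Rightarrow> real^'n^'n" where
  "diag_mat v = (\<chi> i j. if i = j then v $ i else 0)"

definition ddag_mat :: "real^'n \<Rightarrow> real^'n^'n" where
  "ddag_mat v = diag_mat (\<chi> i. ddag (v $ i))"

definition vdiv :: "real^'n \<Rightarrow> real^'n \<Rightarrow> real^'n" (infixl \<open>vdiv\<close> 70) where
  "a vdiv v = ddag_mat v *v a"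

definition mdiv :: "real^'n^'m \<Rightarrow> real^'n^'m \<Rightarrow> real^'n^'m" (infixl \<open>mdiv\<close> 70) where
  "A mdiv B = (\<chi> i j. ddag (B $ i $ j) * A $ i $ j)"

definition vabs :: "real^'n \<Rightarrow> real^'n" where
  "vabs v = (\<chi> i. \<bar>v $ i\<bar>)"

definition mabs :: "real^'n^'m \<Rightarrow> real^'n^'m" where
  "mabs A = (\<chi> i j. \<bar>A $ i $ j\<bar>)"

text \<open>The max norm of vectors is the library's \<open>infnorm\<close>.  On matrices \<open>infnorm\<close> would be
  the largest entry, so the matrix norm is defined separately; that it is the norm induced by
  \<open>infnorm\<close> is lemma \<open>mat_infnorm_induced\<close> below.\<close>

definition mat_infnorm :: "real^'n^'m \<Rightarrow> real" where
  "mat_infnorm A = Max (range (\<lambda>i. \<Sum>j\<in>UNIV. \<bar>A $ i $ j\<bar>))"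

text \<open>Vectors obtained from an \<open>m \<times> n\<close> matrix by stacking its columns are indexed by pairs
  (column, row), the column index being the major one.  Kronecker products are indexed
  accordingly.\<close>

definition vectorize :: "real^'n^'m \<Rightarrow> real^('n \<times> 'm)" where
  "vectorize X = (\<chi> a. X $ snd a $ fst a)"

definition kron :: "real^'b^'a \<Rightarrow> real^'d^'c \<Rightarrow> real^('b \<times> 'd)^('a \<times> 'c)" where
  "kron P Q = (\<chi> i j. P $ fst i $ fst j * Q $ snd i $ snd j)"

text \<open>The product of the one-row matrix \<open>v\<close>\<open>\<^sup>T\<close> with \<open>Q\<close>, its row index type \<open>1 \<times> 'c\<close> being
  identified with \<open>'c\<close>.\<close>

definition kron_row :: "real^'b \<Rightarrow> real^'d^'c \<Rightarrow> real^('b \<times> 'd)^'c" where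
  "kron_row v Q = (\<chi> i. kron (rowvector v :: real^'b^1) Q $ (1, i))"

definition vec_perm :: "real^('n::finite \<times> 'm::finite)^('m \<times> 'n)" where
  "vec_perm = (\<chi> a c. if a = prod.swap c then 1 else 0)"

definition stack :: "real^'a \<Rightarrow> real^'b \<Rightarrow> real^('a + 'b)" where
  "stack u v = (\<chi> i. case i of Inl a \<Rightarrow> u $ a | Inr b \<Rightarrow> v $ b)"

definition row_block :: "real^'a^'k \<Rightarrow> real^'b^'k \<Rightarrow> real^('a + 'b)^'k" where
  "row_block P Q = (\<chi> i. stack (P $ i) (Q $ i))"

definition block_diag :: "real^'c^'a \<Rightarrow> real^'d^'b \<Rightarrow> real^('c + 'd)^('a + 'b)" where
  "block_diag P Q = (\<chi> i. case i of Inl a \<Rightarrow> stack (P $ a) 0 | Inr b \<Rightarrow> stack 0 (Q $ b))"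

section \<open>Structured matrices and vectors\<close>

definition structure_matrix :: "real^'k^'m \<Rightarrow> bool" where
  "structure_matrix \<Phi> \<longleftrightarrow>
     (\<forall>j. column j \<Phi> \<noteq> 0) \<and>
     (\<forall>i j. i \<noteq> j \<longrightarrow> orthogonal (column i \<Phi>) (column j \<Phi>)) \<and>
     (\<forall>s \<phi>. (\<forall>j. \<phi> $ j = 0 \<longrightarrow> s $ j = 0) \<longrightarrow> (\<Phi> *v s) vdiv (\<Phi> *v \<phi>) = \<Phi> *v (s vdiv \<phi>)) \<and>
     (\<forall>y. infnorm (\<Phi> *v y) = infnorm y)"

definition structured_matrices :: "real^'k^('n \<times> 'm) \<Rightarrow> (real^'n^'m) set" where
  "structured_matrices \<Phi> = {X. \<exists>s. vectorize X = \<Phi> *v s}"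

definition structured_vectors :: "real^'k^'m \<Rightarrow> (real^'m) set" where
  "structured_vectors \<Phi> = {y. \<exists>s. y = \<Phi> *v s}"

section \<open>The indefinite least squares problem\<close>

definition pos_def :: "real^'n^'n \<Rightarrow> bool" where
  "pos_def M \<longleftrightarrow> transpose M = M \<and> (\<forall>v. v \<noteq> 0 \<longrightarrow> v \<bullet> (M *v v) > 0)"

text \<open>\<open>diag(I\<^sub>p, -I\<^sub>q)\<close> with \<open>q = CARD('m) - p\<close>: the \<open>p\<close> smallest indices of the linearly
  ordered index type \<open>'m\<close> carry \<open>1\<close>, the others \<open>-1\<close>.\<close>

definition sig_mat :: "nat \<Rightarrow> real^'m::{finite,linorder}^'m::{finite,linorder}" where
  "sig_mat p = diag_mat (\<chi> i. if card {l. l < i} < p then 1 else -1)"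

definition ils_objective :: "nat \<Rightarrow> real^'n^'m::{finite,linorder} \<Rightarrow> real^'m::{finite,linorder} \<Rightarrow> real^'n \<Rightarrow> real" where
  "ils_objective p A b y = (b - A *v y) \<bullet> (sig_mat p *v (b - A *v y))"

definition ils_gram :: "nat \<Rightarrow> real^'n^'m::{finite,linorder} \<Rightarrow> real^'n^'n" where
  "ils_gram p A = transpose A ** sig_mat p ** A"

definition ils_sol :: "nat \<Rightarrow> real^'n^'m::{finite,linorder} \<Rightarrow> real^'m::{finite,linorder} \<Rightarrow> real^'n" where
  "ils_sol p A b = matrix_inv (ils_gram p A) *v (transpose A *v (sig_mat p *v b))"

definition ils_resid :: "nat \<Rightarrow> real^'n^'m::{finite,linorder} \<Rightarrow> real^'m::{finite,linorder} \<Rightarrow> real^'m::{finite,linorder}" where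
  "ils_resid p A b = b - A *v ils_sol p A b"

definition ils_map ::
  "nat \<Rightarrow> real^'k^'n \<Rightarrow> (real^'n^'m::{finite,linorder}) \<times> (real^'m::{finite,linorder}) \<Rightarrow> real^'k" where
  "ils_map p L z = transpose L *v ils_sol p (fst z) (snd z)"

definition ils_M ::
  "nat \<Rightarrow> real^'k^'n \<Rightarrow> real^'n^'m::{finite,linorder} \<Rightarrow> real^'m::{finite,linorder} \<Rightarrow> real^(('n \<times> 'm) + 'm)^'k" where
  "ils_M p L A b =
     (let J = sig_mat p; K = transpose L ** matrix_inv (ils_gram p A);
          x = ils_sol p A b; r = ils_resid p A b
      in row_block
           (kron_row (J *v r) K ** vec_perm - kron_row x (K ** transpose A ** J))
           (K ** transpose A ** J))"

section \<open>Structured condition numbers\<close>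

text \<open>The derivative \<open>g'(A,b)\<close> is the library's Frechet derivative of \<open>ils_map p L\<close> on the whole
  space; lemma \<open>ils_map_has_derivative\<close> below gives its closed form.  The supremum is taken in
  the nonnegative extended reals, so it is a genuine least upper bound, and it is \<open>0\<close> in the
  degenerate case \<open>\<Psi> = 0\<close>, \<open>\<beta> = 0\<close>, in which there are no admissible perturbations.\<close>

definition struct_perturbations ::
  "(real^'n^'m) set \<Rightarrow> (real^'m) set \<Rightarrow> real^'n^'m \<Rightarrow> real^'m \<Rightarrow> ((real^'n^'m) \<times> (real^'m)) set" where
  "struct_perturbations S1 S2 \<Psi> \<beta> =
     {(\<Delta>A, \<Delta>b). \<Delta>A \<in> S1 \<and> \<Delta>b \<in> S2 \<and>
        (\<forall>i j. \<Psi> $ i $ j = 0 \<longrightarrow> \<Delta>A $ i $ j = 0) \<and> (\<forall>i. \<beta> $ i = 0 \<longrightarrow> \<Delta>b $ i = 0) \<and>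
        infnorm (stack (vectorize (\<Delta>A mdiv \<Psi>)) (\<Delta>b vdiv \<beta>)) \<noteq> 0}"

definition cond_inf_ILS ::
  "nat \<Rightarrow> real^'k^'n \<Rightarrow> (real^'n^'m::{finite,linorder}) set \<Rightarrow> (real^'m::{finite,linorder}) set \<Rightarrow>
   real^'n^'m::{finite,linorder} \<Rightarrow> real^'m::{finite,linorder} \<Rightarrow> real^'k \<Rightarrow> real^'n^'m::{finite,linorder} \<Rightarrow> real^'m::{finite,linorder} \<Rightarrow> ennreal" where
  "cond_inf_ILS p L S1 S2 \<Psi> \<beta> \<xi> A b =
     (SUP (\<Delta>A, \<Delta>b) \<in> struct_perturbations S1 S2 \<Psi> \<beta>.
        ennreal (infnorm (frechet_derivative (ils_map p L) (at (A, b)) (\<Delta>A, \<Delta>b) vdiv \<xi>)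
                 / infnorm (stack (vectorize (\<Delta>A mdiv \<Psi>)) (\<Delta>b vdiv \<beta>))))"

definition cond_mixed_ILS ::
  "nat \<Rightarrow> real^'k^'n \<Rightarrow> (real^'n^'m::{finite,linorder}) set \<Rightarrow> (real^'m::{finite,linorder}) set \<Rightarrow>
   real^'n^'m::{finite,linorder} \<Rightarrow> real^'m::{finite,linorder} \<Rightarrow> ennreal" where
  "cond_mixed_ILS p L S1 S2 A b =
     cond_inf_ILS p L S1 S2 A b (\<chi> i. infnorm (transpose L *v ils_sol p A b)) A b"

definition cond_comp_ILS ::
  "nat \<Rightarrow> real^'k^'n \<Rightarrow> (real^'n^'m::{finite,linorder}) set \<Rightarrow> (real^'m::{finite,linorder}) set \<Rightarrow>
   real^'n^'m::{finite,linorder} \<Rightarrow> real^'m::{finite,linorder} \<Rightarrow> ennreal" where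
  "cond_comp_ILS p L S1 S2 A b =
     cond_inf_ILS p L S1 S2 A b (transpose L *v ils_sol p A b) A b"

section \<open>Checks of the conventions\<close>

lemma vec_perm_vectorize:
  fixes X :: "real^'n^'m"
  shows "vec_perm *v vectorize X = vectorize (transpose X)"
proof -
  have "(\<Sum>c\<in>UNIV. (if a = prod.swap c then 1 else 0) * X $ snd c $ fst c)
      = X $ fst a $ snd a" for a :: "'m \<times> 'n"
  proof -
    have "(\<Sum>c\<in>UNIV. (if a = prod.swap c then 1 else 0) * X $ snd c $ fst c)
       = (\<Sum>c\<in>UNIV. if c = prod.swap a then X $ snd c $ fst c else 0)"
      by (rule sum.cong) auto
    then show ?thesis by simp
  qed
  then show ?thesis
    by (simp add: vec_eq_iff vec_perm_def vectorize_def matrix_vector_mult_def transpose_def)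
qed

lemma kron_vectorize:
  fixes P :: "real^'n^'m" and X :: "real^'k^'n" and Q :: "real^'l^'k"
  shows "kron (transpose Q) P *v vectorize X = vectorize (P ** X ** Q)"
proof -
  have "(\<Sum>c\<in>(UNIV::('k \<times> 'n) set). Q $ fst c $ a * P $ i $ snd c * X $ snd c $ fst c)
      = (\<Sum>j\<in>UNIV. (\<Sum>l\<in>UNIV. P $ i $ l * X $ l $ j) * Q $ j $ a)" for a i
    unfolding UNIV_Times_UNIV[symmetric] sum_distrib_right
    by (subst sum.cartesian_product) (auto intro!: sum.cong simp: mult_ac)
  then show ?thesis
    by (simp add: vec_eq_iff kron_def vectorize_def matrix_vector_mult_def matrix_matrix_mult_def
        transpose_def)
qed

lemma mat_infnorm_induced:
  fixes A :: "real^'n^'m"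
  shows "mat_infnorm A = (SUP v\<in>-{0}. infnorm (A *v v) / infnorm v)"
proof -
  have ub: "infnorm w \<le> c" if "\<And>i. \<bar>w $ i\<bar> \<le> c" for w :: "real^'k" and c
    unfolding infnorm_cart using that by (auto intro!: cSup_least)
  define R where "R = (\<lambda>i. \<Sum>j\<in>UNIV. \<bar>A $ i $ j\<bar>)"
  have R: "mat_infnorm A = Max (range R)" by (simp add: mat_infnorm_def R_def)
  have le: "infnorm (A *v v) / infnorm v \<le> mat_infnorm A" if "v \<noteq> 0" for v
  proof -
    have pos: "infnorm v > 0" using that infnorm_pos_lt by blast
    have "\<bar>(A *v v) $ i\<bar> \<le> mat_infnorm A * infnorm v" for i
    proof -
      have "\<bar>(A *v v) $ i\<bar> \<le> (\<Sum>j\<in>UNIV. \<bar>A $ i $ j * v $ j\<bar>)"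
        by (simp add: matrix_vector_mult_def sum_abs)
      also have "\<dots> \<le> (\<Sum>j\<in>UNIV. \<bar>A $ i $ j\<bar> * infnorm v)"
        by (intro sum_mono) (auto simp: abs_mult intro: mult_left_mono component_le_infnorm_cart)
      also have "\<dots> = R i * infnorm v" by (simp add: R_def sum_distrib_right)
      also have "\<dots> \<le> mat_infnorm A * infnorm v"
        using pos by (intro mult_right_mono) (auto simp: R)
      finally show ?thesis .
    qed
    then show ?thesis using ub[of "A *v v"] pos by (simp add: divide_le_eq)
  qed
  have "Max (range R) \<in> range R" by (rule Max_in) auto
  then obtain i where i: "mat_infnorm A = R i" unfolding R by (elim imageE) auto
  define v :: "real^'n" where "v = (\<chi> j. if A $ i $ j < 0 then -1 else 1)"
  have v0: "v \<noteq> 0" by (auto simp: v_def vec_eq_iff)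
  have v1: "infnorm v \<le> 1" by (rule ub) (auto simp: v_def)
  have "mat_infnorm A = (A *v v) $ i"
    unfolding i by (auto simp: R_def v_def matrix_vector_mult_def intro!: sum.cong)
  also have "\<dots> \<le> infnorm (A *v v)" using component_le_infnorm_cart[of "A *v v" i] by simp
  also have "\<dots> \<le> infnorm (A *v v) / infnorm v"
    using v0 v1 infnorm_pos_lt[of v] infnorm_pos_le[of "A *v v"]
    by (simp add: le_divide_eq mult_left_le)
  finally have ge: "mat_infnorm A \<le> infnorm (A *v v) / infnorm v" .
  have "(SUP v\<in>-{0}. infnorm (A *v v) / infnorm v) = mat_infnorm A"
  proof (rule cSup_eq_maximum)
    show "mat_infnorm A \<in> (\<lambda>v. infnorm (A *v v) / infnorm v) ` (- {0})"
      using le[OF v0] ge v0 by (intro image_eqI[of _ _ v]) auto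
  qed (use le in auto)
  then show ?thesis by simp
qed

lemma pos_def_invertible:
  assumes "pos_def M"
  shows "invertible M"
proof -
  have "v = 0" if "M *v v = 0" for v
    using assms that unfolding pos_def_def by (metis inner_zero_right less_irrefl)
  then show ?thesis by (simp add: invertible_left_inverse matrix_left_invertible_ker)
qed

lemma matrix_inv_cancel:
  assumes "invertible M"
  shows "M *v (matrix_inv M *v c) = c" "matrix_inv M *v (M *v c) = c"
  using someI_ex[OF assms[unfolded invertible_def]]
  by (simp_all add: matrix_inv_def matrix_vector_mul_assoc)

lemma transpose_sig_mat: "transpose (sig_mat p) = sig_mat p"
  by (simp add: sig_mat_def diag_mat_def transpose_def vec_eq_iff)

lemma ils_sol_unique_minimizer:
  fixes A :: "real^'n^'m::{finite,linorder}"
  assumes "pos_def (ils_gram p A)" and "y \<noteq> ils_sol p A b"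
  shows "ils_objective p A b (ils_sol p A b) < ils_objective p A b y"
proof -
  let ?J = "sig_mat p :: real^'m::{finite,linorder}^'m::{finite,linorder}"
  define x where "x = ils_sol p A b"
  define r where "r = b - A *v x"
  define u where "u = y - x"
  have "ils_gram p A *v x = transpose A *v (?J *v b)"
    unfolding x_def ils_sol_def by (rule matrix_inv_cancel(1)[OF pos_def_invertible[OF assms(1)]])
  then have normal: "transpose A *v (?J *v r) = 0"
    by (simp add: r_def ils_gram_def matrix_vector_mult_diff_distrib matrix_vector_mul_assoc
        matrix_mul_assoc)
  have 1: "(A *v u) \<bullet> (?J *v r) = 0"
    using normal by (metis dot_lmul_matrix inner_zero_right transpose_matrix_vector
        transpose_transpose vector_transpose_matrix)
  have 2: "r \<bullet> (?J *v (A *v u)) = 0"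
    using 1 by (metis dot_lmul_matrix inner_commute transpose_matrix_vector transpose_sig_mat)
  have 3: "(A *v u) \<bullet> (?J *v (A *v u)) = u \<bullet> (ils_gram p A *v u)"
    unfolding ils_gram_def
    by (metis dot_lmul_matrix matrix_vector_mul_assoc transpose_transpose vector_transpose_matrix)
  have "b - A *v y = r - A *v u"
    by (simp add: r_def u_def matrix_vector_mult_diff_distrib)
  then have "ils_objective p A b y = r \<bullet> (?J *v r) + u \<bullet> (ils_gram p A *v u)"
    using 1 2 3
    by (simp add: ils_objective_def matrix_vector_mult_diff_distrib inner_diff_left inner_diff_right)
  moreover have "u \<bullet> (ils_gram p A *v u) > 0"
    using assms by (auto simp: pos_def_def u_def x_def)
  ultimately show ?thesis by (simp add: ils_objective_def r_def x_def)
qed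

lemma bounded_bilinear_matrix_vector:
  "bounded_bilinear (\<lambda>(A::real^'n^'m) v. A *v v)"
  by (intro bilinear_conv_bounded_bilinear[THEN iffD1] bilinear_def[THEN iffD2] conjI allI linearI)
     (simp_all add: vec_eq_iff matrix_vector_mult_def distrib_left distrib_right sum.distrib
        sum_distrib_left mult_ac)

lemma bounded_bilinear_matrix_mult:
  "bounded_bilinear (\<lambda>(A::real^'n^'m) (B::real^'k^'n). A ** B)"
  by (intro bilinear_conv_bounded_bilinear[THEN iffD1] bilinear_def[THEN iffD2] conjI allI linearI)
     (simp_all add: vec_eq_iff matrix_matrix_mult_def distrib_left distrib_right sum.distrib
        sum_distrib_left mult_ac)

lemma bounded_linear_transpose: "bounded_linear (transpose :: real^'n^'m \<Rightarrow> real^'m^'n)"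
  by (intro linear_conv_bounded_linear[THEN iffD1] linearI)
     (simp_all add: vec_eq_iff transpose_def)

lemma has_derivative_bilinear_zero:
  fixes prod :: "'a::real_normed_vector \<Rightarrow> 'b::real_normed_vector \<Rightarrow> 'c::real_normed_vector"
    and u :: "'d::real_normed_vector \<Rightarrow> 'a"
  assumes B: "bounded_bilinear prod" and u: "(u has_derivative u') (at z)" and "u z = 0"
    and v: "isCont v z"
  shows "((\<lambda>w. prod (u w) (v w)) has_derivative (\<lambda>h. prod (u' h) (v z))) (at z)"
proof -
  interpret bounded_bilinear prod by (rule B)
  have "((\<lambda>w. prod (u w) (v z)) has_derivative (\<lambda>h. prod (u' h) (v z))) (at z)"
    by (rule bounded_linear.has_derivative[OF bounded_linear_left u])
  moreover have "((\<lambda>w. prod (u w) (v w - v z)) has_derivative (\<lambda>h. 0)) (at z)"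
  proof -
    obtain K where K: "\<And>a b. norm (prod a b) \<le> norm a * norm b * K" and "K > 0"
      using pos_bounded by blast
    obtain C where C: "\<And>h. norm (u' h) \<le> norm h * C" and "C > 0"
      using bounded_linear.pos_bounded[OF has_derivative_bounded_linear[OF u]] by blast
    have "\<forall>\<^sub>F w in at z. norm (u w - u z - u' (w - z)) \<le> 1 * norm (w - z)"
      using u unfolding has_derivative_at_alt eventually_at
      by (metis dist_norm zero_less_one)
    then have "\<forall>\<^sub>F w in at z. norm (prod (u w) (v w - v z) /\<^sub>R norm (w - z))
        \<le> (1 + C) * norm (v w - v z) * K"
    proof eventually_elim
      case (elim w)
      have "norm (u w) \<le> norm (u w - u z - u' (w - z)) + norm (u' (w - z))"
        using norm_triangle_ineq[of "u w - u z - u' (w - z)" "u' (w - z)"] assms(3) by simp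
      also have "\<dots> \<le> (1 + C) * norm (w - z)"
        using elim C[of "w - z"] by (simp add: algebra_simps)
      finally have nu: "norm (u w) \<le> (1 + C) * norm (w - z)" .
      have "norm (prod (u w) (v w - v z)) \<le> norm (u w) * norm (v w - v z) * K" by (rule K)
      also have "\<dots> \<le> (1 + C) * norm (w - z) * norm (v w - v z) * K"
        using nu \<open>K > 0\<close> by (intro mult_right_mono) auto
      finally have *: "norm (prod (u w) (v w - v z)) \<le> (1 + C) * norm (v w - v z) * K * norm (w - z)"
        by (simp add: mult_ac)
      show ?case
        using * \<open>C > 0\<close> \<open>K > 0\<close>
        by (cases "w = z") (simp_all add: divide_simps mult_ac)
    qed
    moreover have "((\<lambda>w. (1 + C) * norm (v w - v z) * K) \<longlongrightarrow> 0) (at z)"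
      using v unfolding isCont_def by (auto intro!: tendsto_eq_intros)
    ultimately have "((\<lambda>w. prod (u w) (v w - v z) /\<^sub>R norm (w - z)) \<longlongrightarrow> 0) (at z)"
      by (rule Lim_null_comparison)
    then show ?thesis
      by (simp add: has_derivative_at_within zero_right bounded_linear_zero)
  qed
  ultimately have "((\<lambda>w. prod (u w) (v z) + prod (u w) (v w - v z)) has_derivative
      (\<lambda>h. prod (u' h) (v z) + 0)) (at z)"
    by (rule has_derivative_add)
  then show ?thesis by (simp add: add_right[symmetric])
qed

lemma isCont_det:
  fixes F :: "'a::t2_space \<Rightarrow> real^'n^'n"
  assumes "\<And>i j. isCont (\<lambda>w. F w $ i $ j) z"
  shows "isCont (\<lambda>w. det (F w)) z"
  unfolding det_def by (intro continuous_intros assms)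

lemma ils_map_has_derivative:
  fixes A :: "real^'n^'m::{finite,linorder}" and b :: "real^'m::{finite,linorder}" and L :: "real^'k^'n"
  assumes pd: "pos_def (ils_gram p A)"
  defines "J \<equiv> sig_mat p" and "K \<equiv> transpose L ** matrix_inv (ils_gram p A)"
  shows "(ils_map p L has_derivative
           (\<lambda>(\<Delta>A, \<Delta>b). K *v (transpose \<Delta>A *v (J *v ils_resid p A b))
              - K *v (transpose A *v (J *v (\<Delta>A *v ils_sol p A b)))
              + K *v (transpose A *v (J *v \<Delta>b)))) (at (A, b))"
proof -
  note MV = bounded_bilinear_matrix_vector and MM = bounded_bilinear_matrix_mult
  define G where "G = (\<lambda>z::(real^'n^'m::{finite,linorder}) \<times> (real^'m::{finite,linorder}). transpose (fst z) ** J ** fst z)"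
  define c where "c = (\<lambda>z::(real^'n^'m::{finite,linorder}) \<times> (real^'m::{finite,linorder}). transpose (fst z) *v (J *v snd z))"
  define y where "y = (\<lambda>z::(real^'n^'m::{finite,linorder}) \<times> (real^'m::{finite,linorder}). ils_sol p (fst z) (snd z))"
  define z where "z = (A, b)"
  define N where "N = matrix_inv (G z)"
  have Gz: "G z = ils_gram p A" by (simp add: G_def z_def ils_gram_def J_def)
  have y: "y w = matrix_inv (G w) *v c w" for w
    by (simp add: y_def ils_sol_def c_def G_def ils_gram_def J_def)
  have dT: "((\<lambda>w. transpose (fst w :: real^'n^'m::{finite,linorder})) has_derivative (\<lambda>h. transpose (fst h))) (at z)"
    by (intro bounded_linear.has_derivative[OF bounded_linear_transpose] has_derivative_fst
        has_derivative_ident)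
  have dJ: "((\<lambda>w. transpose (fst w :: real^'n^'m::{finite,linorder}) ** J) has_derivative
      (\<lambda>h. transpose (fst h) ** J)) (at z)"
    by (rule bounded_linear.has_derivative[OF bounded_bilinear.bounded_linear_left[OF MM] dT])
  have dG: "(G has_derivative (\<lambda>h. (transpose A ** J) ** fst h + (transpose (fst h) ** J) ** A)) (at z)"
    unfolding G_def
    by (rule has_derivative_eq_rhs[OF bounded_bilinear.FDERIV[OF MM dJ
          has_derivative_fst[OF has_derivative_ident]]]) (simp add: z_def)
  have db: "((\<lambda>w. J *v snd w) has_derivative (\<lambda>h. J *v snd h)) (at z)"
    by (intro bounded_linear.has_derivative[OF bounded_bilinear.bounded_linear_right[OF MV]]
        has_derivative_snd has_derivative_ident)
  have dc: "(c has_derivative (\<lambda>h. transpose A *v (J *v snd h) + transpose (fst h) *v (J *v b))) (at z)"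
    unfolding c_def
    by (rule has_derivative_eq_rhs[OF bounded_bilinear.FDERIV[OF MV dT db]]) (simp add: z_def)
  have cG: "isCont (\<lambda>w. G w $ i $ j) z" for i j
    by (intro continuous_intros has_derivative_continuous[OF dG])
  have cc: "isCont (\<lambda>w. c w $ i) z" for i
    by (intro continuous_intros has_derivative_continuous[OF dc])
  have det0: "det (G z) \<noteq> 0"
    using pos_def_invertible[OF pd] by (simp add: Gz invertible_det_nz)
  have cdet: "isCont (\<lambda>w. det (G w)) z" by (rule isCont_det[OF cG])
  have ev: "\<forall>\<^sub>F w in nhds z. det (G w) \<noteq> 0"
    using cdet det0 unfolding isCont_def eventually_nhds_conv_at
    by (auto intro: tendsto_imp_eventually_ne)
  have eq: "G w *v y w = c w" if "det (G w) \<noteq> 0" for w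
    unfolding y using that by (intro matrix_inv_cancel(1)) (simp add: invertible_det_nz)
  define Y where "Y = (\<lambda>w. (\<chi> k. det (\<chi> i j. if j = k then c w $ i else G w $ i $ j) / det (G w)))"
  have yY: "y w = Y w" if "det (G w) \<noteq> 0" for w
    using cramer[OF that] eq[OF that] unfolding Y_def by blast
  have cY: "isCont Y z"
    unfolding Y_def isCont_def
  proof (intro tendsto_vec_lambda)
    fix k
    have "isCont (\<lambda>w. (\<chi> i j. if j = k then c w $ i else G w $ i $ j) $ i $ j) z" for i j
      using cG[of i j] cc[of i] by (cases "j = k") auto
    then have "isCont (\<lambda>w. det (\<chi> i j. if j = k then c w $ i else G w $ i $ j)) z"
      by (rule isCont_det)
    then show "(\<lambda>w. det (\<chi> i j. if j = k then c w $ i else G w $ i $ j) / det (G w)) \<midarrow>z\<rightarrow>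
        det (\<chi> i j. if j = k then c z $ i else G z $ i $ j) / det (G z)"
      using cdet det0 unfolding isCont_def by (intro tendsto_divide)
  qed
  have dD: "((\<lambda>w. (G w - G z) *v Y w) has_derivative
      (\<lambda>h. ((transpose A ** J) ** fst h + (transpose (fst h) ** J) ** A) *v Y z)) (at z)"
    by (rule has_derivative_bilinear_zero[OF MV _ _ cY])
       (auto intro!: derivative_eq_intros dG)
  have rep: "y w = N *v (c w - (G w - G z) *v Y w)" if "det (G w) \<noteq> 0" for w
  proof -
    have "c w - (G w - G z) *v Y w = G z *v y w"
      using eq[OF that] yY[OF that] by (simp add: matrix_vector_mult_diff_rdistrib)
    then show ?thesis
      using matrix_inv_cancel(2)[OF pos_def_invertible[OF pd[folded Gz]]] by (simp add: N_def)
  qed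
  define D where "D = (\<lambda>h::(real^'n^'m::{finite,linorder}) \<times> (real^'m::{finite,linorder}). N *v
      (transpose A *v (J *v snd h) + transpose (fst h) *v (J *v b)
       - ((transpose A ** J) ** fst h + (transpose (fst h) ** J) ** A) *v Y z))"
  have "((\<lambda>w. N *v (c w - (G w - G z) *v Y w)) has_derivative D) (at z)"
    unfolding D_def
    by (intro bounded_linear.has_derivative[OF bounded_bilinear.bounded_linear_right[OF MV]]
        has_derivative_diff dc dD)
  moreover have "\<forall>\<^sub>F w in at z. N *v (c w - (G w - G z) *v Y w) = y w"
    using ev by (auto simp: eventually_nhds_conv_at rep elim: eventually_mono)
  ultimately have "(y has_derivative D) (at z)"
    using rep[OF det0] by (auto intro: has_derivative_transform_eventually)
  then have "((\<lambda>w. transpose L *v y w) has_derivative (\<lambda>h. transpose L *v D h)) (at z)"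
    by (intro bounded_linear.has_derivative[OF bounded_bilinear.bounded_linear_right[OF MV]])
  moreover have "(\<lambda>w. transpose L *v y w) = ils_map p L"
    by (simp add: fun_eq_iff ils_map_def y_def)
  moreover have "Y z = ils_sol p A b"
    using yY[OF det0] by (simp add: y_def z_def)
  ultimately show ?thesis
    by (simp add: z_def D_def N_def Gz[unfolded z_def] K_def ils_resid_def case_prod_unfold
        matrix_vector_mul_assoc matrix_mul_assoc matrix_vector_right_distrib
        matrix_vector_mult_diff_distrib matrix_vector_mult_add_rdistrib algebra_simps)
qed

corollary frechet_derivative_ils_map:
  fixes A :: "real^'n^'m::{finite,linorder}" and b :: "real^'m::{finite,linorder}" and L :: "real^'k^'n"
  assumes "pos_def (ils_gram p A)"
  defines "J \<equiv> sig_mat p" and "K \<equiv> transpose L ** matrix_inv (ils_gram p A)"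
  shows "frechet_derivative (ils_map p L) (at (A, b)) (\<Delta>A, \<Delta>b)
         = K *v (transpose \<Delta>A *v (J *v ils_resid p A b))
           - K *v (transpose A *v (J *v (\<Delta>A *v ils_sol p A b)))
           + K *v (transpose A *v (J *v \<Delta>b))"
  using frechet_derivative_at[OF ils_map_has_derivative[OF assms(1), of L b], symmetric]
  by (simp add: J_def K_def)

end

theory Submission
  imports Defs
begin

text \<open>With \<open>\<Phi> = diag(\<Phi>\<^sub>1, \<Phi>\<^sub>2)\<close> and \<open>w = vec(\<phi>, \<theta>)\<close>, the admissible perturbations are exactly the
  vectors \<open>\<Phi> (w \<cdot> u)\<close> (entrywise product) with \<open>u\<close> supported where \<open>w\<close> is nonzero.  The structure
  axioms give \<open>\<Phi> (w \<cdot> u) / \<Phi> w = \<Phi> u\<close>, which has the same max norm as \<open>u\<close>.  So the condition number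
  is the norm of \<open>diag\<^sup>\<ddagger>(\<xi>) M\<^sub>g\<^sub>' \<Phi> diag(w)\<close> induced by the max norm, restricted to vectors supported
  on the support of \<open>w\<close>; the restriction is harmless since the other columns of that matrix vanish.\<close>

section \<open>The max norm of vectors and the row-sum norm of matrices\<close>

lemma infnorm_le_iff_cart:
  fixes v :: "real^'n"
  shows "infnorm v \<le> c \<longleftrightarrow> (\<forall>i. \<bar>v $ i\<bar> \<le> c)"
proof
  assume "infnorm v \<le> c"
  then show "\<forall>i. \<bar>v $ i\<bar> \<le> c"
    using component_le_infnorm_cart[of v] by (meson order_trans)
next
  assume "\<forall>i. \<bar>v $ i\<bar> \<le> c"
  then show "infnorm v \<le> c"
    unfolding infnorm_cart by (auto intro!: cSup_least)
qed

lemma mat_infnorm_le_iff: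
  fixes B :: "real^'n^'m"
  shows "mat_infnorm B \<le> c \<longleftrightarrow> (\<forall>i. (\<Sum>j\<in>UNIV. \<bar>B $ i $ j\<bar>) \<le> c)"
  by (auto simp: mat_infnorm_def)

lemma row_sum_le_mat_infnorm: "(\<Sum>j\<in>UNIV. \<bar>B $ i $ j\<bar>) \<le> mat_infnorm B"
  using mat_infnorm_le_iff by blast

lemma mat_infnorm_attained:
  fixes B :: "real^'n^'m"
  obtains i where "mat_infnorm B = (\<Sum>j\<in>UNIV. \<bar>B $ i $ j\<bar>)"
proof -
  have "mat_infnorm B \<in> range (\<lambda>i. \<Sum>j\<in>UNIV. \<bar>B $ i $ j\<bar>)"
    unfolding mat_infnorm_def by (rule Max_in) auto
  then show ?thesis using that by blast
qed

lemma infnorm_matrix_vector_le: "infnorm (B *v v) \<le> mat_infnorm B * infnorm v"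
proof -
  have "\<bar>(B *v v) $ i\<bar> \<le> mat_infnorm B * infnorm v" for i
  proof -
    have "\<bar>(B *v v) $ i\<bar> \<le> (\<Sum>j\<in>UNIV. \<bar>B $ i $ j * v $ j\<bar>)"
      by (simp add: matrix_vector_mult_def sum_abs)
    also have "\<dots> \<le> (\<Sum>j\<in>UNIV. \<bar>B $ i $ j\<bar>) * infnorm v"
      unfolding sum_distrib_right
      by (intro sum_mono) (auto simp: abs_mult intro: mult_left_mono component_le_infnorm_cart)
    also have "\<dots> \<le> mat_infnorm B * infnorm v"
      by (intro mult_right_mono row_sum_le_mat_infnorm infnorm_pos_le)
    finally show ?thesis .
  qed
  then show ?thesis by (simp add: infnorm_le_iff_cart)
qed

text \<open>Both numbers have the same upper bounds, hence agree. The row-sum norm thereby becomes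
  the max norm of a vector, the shape of the second formula for the condition number.\<close>

lemma mat_infnorm_eq_infnorm:
  fixes B :: "real^'n^'m"
  shows "mat_infnorm B = infnorm (\<chi> i. \<Sum>j\<in>UNIV. \<bar>B $ i $ j\<bar>)"
proof -
  have "mat_infnorm B \<le> c \<longleftrightarrow> infnorm (\<chi> i. \<Sum>j\<in>UNIV. \<bar>B $ i $ j\<bar>) \<le> c" for c
    by (simp add: mat_infnorm_le_iff infnorm_le_iff_cart abs_of_nonneg sum_nonneg)
  then show ?thesis by (meson order.antisym order.refl)
qed

text \<open>The sign vector of a maximal row attains the norm. It is supported in \<open>T\<close>
  because the row is, so the restricted supremum loses nothing.\<close>

lemma mat_infnorm_Sup_supported:
  fixes B :: "real^'n^'m"
  assumes "\<And>i j. j \<notin> T \<Longrightarrow> B $ i $ j = 0"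
  shows "(SUP u\<in>{u. u \<noteq> 0 \<and> (\<forall>j. j \<notin> T \<longrightarrow> u $ j = 0)}. ennreal (infnorm (B *v u) / infnorm u))
    = ennreal (mat_infnorm B)" (is "Sup (?f ` ?U) = _")
proof (rule antisym)
  show "Sup (?f ` ?U) \<le> ennreal (mat_infnorm B)"
    using infnorm_matrix_vector_le[of B]
    by (intro SUP_least ennreal_leI) (auto simp: divide_le_eq infnorm_pos_lt)
  obtain i where i: "mat_infnorm B = (\<Sum>j\<in>UNIV. \<bar>B $ i $ j\<bar>)"
    by (rule mat_infnorm_attained)
  \<comment> \<open>Since \<open>sgn 0 = 0\<close>, this vector vanishes off \<open>T\<close>; a
    choice of signs 1 and -1 only would not.\<close>
  define u :: "real^'n" where "u = (\<chi> j. sgn (B $ i $ j))"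
  show "ennreal (mat_infnorm B) \<le> Sup (?f ` ?U)"
  proof (cases "u = 0")
    case True
    \<comment> \<open>Here a maximal row is zero. This case includes an empty \<open>?U\<close>,
      whose supremum in \<open>ennreal\<close> is 0.\<close>
    then have "mat_infnorm B = 0"
      by (simp add: i u_def vec_eq_iff sgn_eq_0_iff)
    then show ?thesis by simp
  next
    case False
    then have U: "u \<in> ?U" using assms by (auto simp: u_def)
    have "infnorm u \<le> 1" by (auto simp: infnorm_le_iff_cart u_def sgn_if)
    have "mat_infnorm B = (B *v u) $ i"
      by (simp add: i u_def matrix_vector_mult_def abs_sgn)
    also have "\<dots> \<le> infnorm (B *v u)"
      using component_le_infnorm_cart[of "B *v u" i] by simp
    also have "\<dots> \<le> infnorm (B *v u) / infnorm u"
      using False \<open>infnorm u \<le> 1\<close> infnorm_pos_lt[of u] infnorm_pos_le[of "B *v u"]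
      by (simp add: le_divide_eq mult_left_le)
    finally show ?thesis
      by (intro SUP_upper2[OF U] ennreal_leI)
  qed
qed

section \<open>Entrywise division, diagonal matrices and stacked vectors\<close>

lemma abs_ddag: "\<bar>ddag c\<bar> = ddag \<bar>c\<bar>"
  by (simp add: ddag_def)

lemma diag_mat_mult_vec: "(diag_mat w *v u) $ i = w $ i * u $ i"
  by (simp add: diag_mat_def matrix_vector_mult_def if_distrib[of "\<lambda>x. x * _"] cong: if_cong)

lemma diag_mat_mult_left: "(diag_mat w ** B) $ i $ j = w $ i * B $ i $ j"
  by (simp add: diag_mat_def matrix_matrix_mult_def if_distrib[of "\<lambda>x. x * _"] cong: if_cong)

lemma diag_mat_mult_right: "(B ** diag_mat w) $ i $ j = B $ i $ j * w $ j"
  by (simp add: diag_mat_def matrix_matrix_mult_def if_distrib[of "\<lambda>x. _ * x"] cong: if_cong)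

lemma vdiv_component: "(a vdiv v) $ i = ddag (v $ i) * a $ i"
  by (simp add: vdiv_def ddag_mat_def diag_mat_mult_vec)

lemma stack_component [simp]:
  "stack u v $ Inl a = u $ a" "stack u v $ Inr b = v $ b"
  by (simp_all add: stack_def)

lemma vec_eq_iff_plus:
  fixes x y :: "'c^('a::finite + 'b::finite)"
  shows "x = y \<longleftrightarrow> (\<forall>a. x $ Inl a = y $ Inl a) \<and> (\<forall>b. x $ Inr b = y $ Inr b)"
  by (metis vec_eq_iff sum.exhaust)

lemma stack_eq_iff: "stack u v = stack u' v' \<longleftrightarrow> u = u' \<and> v = v'"
  by (auto simp: vec_eq_iff_plus vec_eq_iff)

lemma stack_cases:
  obtains u v where "x = stack u v"
proof
  show "x = stack (\<chi> a. x $ Inl a) (\<chi> b. x $ Inr b)"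
    by (simp add: vec_eq_iff_plus)
qed

lemma sum_UNIV_plus:
  fixes f :: "'a::finite + 'b::finite \<Rightarrow> 'c::comm_monoid_add"
  shows "sum f UNIV = (\<Sum>a\<in>UNIV. f (Inl a)) + (\<Sum>b\<in>UNIV. f (Inr b))"
  by (simp flip: UNIV_Plus_UNIV add: sum.Plus o_def)

lemma infnorm_stack: "infnorm (stack u v) = max (infnorm u) (infnorm v)"
proof -
  have "infnorm (stack u v) \<le> c \<longleftrightarrow> max (infnorm u) (infnorm v) \<le> c" for c
    by (simp add: infnorm_le_iff_cart) (metis stack_component sum.exhaust)
  then show ?thesis by (meson order.antisym order.refl)
qed

lemma stack_vdiv: "stack a b vdiv stack u v = stack (a vdiv u) (b vdiv v)"
  by (simp add: vec_eq_iff_plus vdiv_component)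

lemma block_diag_mult_stack: "block_diag P Q *v stack u v = stack (P *v u) (Q *v v)"
  by (simp add: vec_eq_iff_plus block_diag_def matrix_vector_mult_def sum_UNIV_plus)

lemma row_block_mult_stack: "row_block P Q *v stack u v = P *v u + Q *v v"
  by (simp add: vec_eq_iff row_block_def matrix_vector_mult_def sum_UNIV_plus)

section \<open>Structure matrices: block sums and zero patterns\<close>

lemma column_block_diag:
  "column (Inl a) (block_diag P Q) = stack (column a P) 0"
  "column (Inr b) (block_diag P Q) = stack 0 (column b Q)"
  by (simp_all add: vec_eq_iff_plus column_def block_diag_def)

lemma orthogonal_stack:
  "orthogonal (stack u v) (stack u' v') \<longleftrightarrow> u \<bullet> u' + v \<bullet> v' = 0"
  by (simp add: orthogonal_def inner_vec_def sum_UNIV_plus)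

text \<open>Allows a pair of a structured matrix and a structured vector to be treated as one
  structured vector. The axioms hold blockwise: columns from different blocks have disjoint
  supports, division acts on the two parts separately, and the max norm of a stack is the larger of
  the two norms.\<close>

lemma structure_matrix_block_diag:
  fixes \<Phi>1 :: "real^'k1^'a" and \<Phi>2 :: "real^'k2^'b"
  assumes "structure_matrix \<Phi>1" and "structure_matrix \<Phi>2"
  shows "structure_matrix (block_diag \<Phi>1 \<Phi>2)"
  unfolding structure_matrix_def
proof (intro conjI allI impI)
  have zero: "(0 :: real^('a + 'b)) = stack 0 0"
    by (simp add: vec_eq_iff_plus)
  show "column j (block_diag \<Phi>1 \<Phi>2) \<noteq> 0" for j
    using assms unfolding structure_matrix_def
    by (cases j) (simp_all add: column_block_diag zero stack_eq_iff)
  show "orthogonal (column i (block_diag \<Phi>1 \<Phi>2)) (column j (block_diag \<Phi>1 \<Phi>2))" if "i \<noteq> j" for i j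
    using assms that unfolding structure_matrix_def
    by (cases i; cases j) (simp_all add: column_block_diag orthogonal_stack, simp_all add: orthogonal_def)
  show "(block_diag \<Phi>1 \<Phi>2 *v s) vdiv (block_diag \<Phi>1 \<Phi>2 *v \<phi>) = block_diag \<Phi>1 \<Phi>2 *v (s vdiv \<phi>)"
    if "\<forall>j. \<phi> $ j = 0 \<longrightarrow> s $ j = 0" for s \<phi>
  proof -
    obtain s1 s2 where s: "s = stack s1 s2" by (rule stack_cases)
    obtain \<phi>1 \<phi>2 where \<phi>: "\<phi> = stack \<phi>1 \<phi>2" by (rule stack_cases)
    have "\<forall>j. \<phi>1 $ j = 0 \<longrightarrow> s1 $ j = 0" "\<forall>j. \<phi>2 $ j = 0 \<longrightarrow> s2 $ j = 0"
      using that unfolding s \<phi> by (metis stack_component)+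
    then show ?thesis
      using assms unfolding structure_matrix_def s \<phi>
      by (simp add: block_diag_mult_stack stack_vdiv)
  qed
  show "infnorm (block_diag \<Phi>1 \<Phi>2 *v y) = infnorm y" for y
  proof -
    obtain y1 y2 where "y = stack y1 y2" by (rule stack_cases)
    then show ?thesis
      using assms unfolding structure_matrix_def
      by (simp add: block_diag_mult_stack infnorm_stack)
  qed
qed

text \<open>A row containing an entry \<open>\<plusminus>1\<close> has no other nonzero entry, because \<open>\<Phi>\<close> does not increase
  the max norm.\<close>

lemma structure_matrix_isolated_row:
  fixes \<Phi> :: "real^'k^'m"
  assumes "structure_matrix \<Phi>"
  obtains i where "\<And>v. \<bar>(\<Phi> *v v) $ i\<bar> = \<bar>v $ j\<bar>"
proof -
  have norm: "infnorm (\<Phi> *v v) = infnorm v" for v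
    using assms by (simp add: structure_matrix_def)
  have "mat_infnorm \<Phi> \<le> 1"
  proof -
    have "ennreal (mat_infnorm \<Phi>) \<le> ennreal 1"
      unfolding mat_infnorm_Sup_supported[of UNIV, simplified, symmetric]
      by (intro SUP_least ennreal_leI) (simp add: norm)
    then show ?thesis by simp
  qed
  \<comment> \<open>Column \<open>j\<close> is the image of a unit vector, so it has an entry of
    modulus at least 1. As row sums are at most 1, this entry has modulus exactly 1 and the rest of
    its row vanishes.\<close>
  have "infnorm (column j \<Phi>) = infnorm (axis j (1::real) :: real^'k)"
    using norm[of "axis j 1"] by (simp add: matrix_vector_mul_component matrix_vector_mult_basis)
  also have "\<dots> \<ge> 1"
    using component_le_infnorm_cart[of "axis j 1 :: real^'k" j] by simp
  finally have ge: "infnorm (column j \<Phi>) \<ge> 1" .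
  have "\<exists>i. \<bar>\<Phi> $ i $ j\<bar> \<ge> 1"
  proof (rule ccontr)
    assume "\<nexists>i. \<bar>\<Phi> $ i $ j\<bar> \<ge> 1"
    then have lt: "\<bar>\<Phi> $ i $ j\<bar> < 1" for i by (meson not_le)
    have "infnorm (column j \<Phi>) \<le> Max (range (\<lambda>i. \<bar>\<Phi> $ i $ j\<bar>))"
      by (auto simp: infnorm_le_iff_cart column_def)
    also have "\<dots> < 1" using lt by (subst Max_less_iff) auto
    finally show False using ge by simp
  qed
  then obtain i where i: "\<bar>\<Phi> $ i $ j\<bar> \<ge> 1" by blast
  have "\<bar>\<Phi> $ i $ j\<bar> + (\<Sum>l\<in>UNIV - {j}. \<bar>\<Phi> $ i $ l\<bar>) \<le> 1"
    using row_sum_le_mat_infnorm[of \<Phi> i] \<open>mat_infnorm \<Phi> \<le> 1\<close>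
    by (simp add: sum.remove[of UNIV j])
  moreover have "0 \<le> (\<Sum>l\<in>UNIV - {j}. \<bar>\<Phi> $ i $ l\<bar>)" by (simp add: sum_nonneg)
  ultimately have one: "\<bar>\<Phi> $ i $ j\<bar> = 1" and "(\<Sum>l\<in>UNIV - {j}. \<bar>\<Phi> $ i $ l\<bar>) = 0"
    using i by linarith+
  then have off: "\<Phi> $ i $ l = 0" if "l \<noteq> j" for l
    using that by (simp add: sum_nonneg_eq_0_iff)
  have "\<bar>(\<Phi> *v v) $ i\<bar> = \<bar>v $ j\<bar>" for v
  proof -
    have "(\<Phi> *v v) $ i = \<Phi> $ i $ j * v $ j"
      using off by (simp add: matrix_vector_mult_def sum.remove[of UNIV j])
    then show ?thesis using one by (simp add: abs_mult)
  qed
  then show ?thesis by (rule that)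
qed

text \<open>Translates the zero requirement on perturbation entries into one on parameters. From
  entries to parameters, the isolated row of each parameter suffices. Conversely,
  \<open>(\<Phi> *v w) $ i\<close> might vanish by cancellation although \<open>w\<close> does not;
  the division axiom then forces \<open>(\<Phi> *v v) $ i\<close> to vanish too.\<close>

lemma structure_matrix_zero_pattern:
  fixes \<Phi> :: "real^'k^'m"
  assumes S: "structure_matrix \<Phi>"
  shows "(\<forall>i. (\<Phi> *v w) $ i = 0 \<longrightarrow> (\<Phi> *v v) $ i = 0) \<longleftrightarrow> (\<forall>j. w $ j = 0 \<longrightarrow> v $ j = 0)"
proof (intro iffI allI impI)
  fix j
  assume *: "\<forall>i. (\<Phi> *v w) $ i = 0 \<longrightarrow> (\<Phi> *v v) $ i = 0" and "w $ j = 0"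
  obtain i where "\<And>v. \<bar>(\<Phi> *v v) $ i\<bar> = \<bar>v $ j\<bar>"
    using structure_matrix_isolated_row[OF S] by blast
  then show "v $ j = 0" using * \<open>w $ j = 0\<close> by (metis abs_eq_0)
next
  fix i
  assume *: "\<forall>j. w $ j = 0 \<longrightarrow> v $ j = 0" and i: "(\<Phi> *v w) $ i = 0"
  have div: "(\<Phi> *v v) vdiv (\<Phi> *v w) = \<Phi> *v (v vdiv w)" if "\<forall>j. w $ j = 0 \<longrightarrow> v $ j = 0" for v w
    using S that by (simp add: structure_matrix_def)
  \<comment> \<open>Dividing by \<open>0\<close> changes nothing, so \<open>(\<Phi> v) $ i\<close> is a quotient by \<open>w\<close> and also by \<open>2 w\<close>.\<close>
  have "(\<Phi> *v v) $ i = (\<Phi> *v (v vdiv w)) $ i"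
    using arg_cong[OF div[OF *], of "\<lambda>x. x $ i"] i by (simp add: vdiv_component ddag_def)
  moreover have "(\<Phi> *v v) $ i = (\<Phi> *v (v vdiv (2 *\<^sub>R w))) $ i"
    using arg_cong[OF div[of "2 *\<^sub>R w" v], of "\<lambda>x. x $ i"] i *
    by (simp add: vdiv_component ddag_def matrix_vector_mult_scaleR)
  \<comment> \<open>At zeros of \<open>w\<close> both sides are 0 because \<open>v\<close> vanishes
    there. Hence \<open>(\<Phi> *v v) $ i\<close> equals half of itself.\<close>
  moreover have "v vdiv (2 *\<^sub>R w) = (1/2) *\<^sub>R (v vdiv w)"
    using * by (auto simp: vec_eq_iff vdiv_component ddag_def)
  ultimately show "(\<Phi> *v v) $ i = 0"
    by (simp add: matrix_vector_mult_scaleR)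
qed

section \<open>The supremum over structured perturbations as a matrix norm\<close>

lemma structured_Sup_eq_mat_infnorm:
  fixes \<Phi> :: "real^'k^'m" and C :: "real^'m^'l" and w :: "real^'k"
  assumes S: "structure_matrix \<Phi>"
  defines "D \<equiv> {d. (\<exists>v. d = \<Phi> *v v) \<and> (\<forall>i. (\<Phi> *v w) $ i = 0 \<longrightarrow> d $ i = 0)
                    \<and> infnorm (d vdiv (\<Phi> *v w)) \<noteq> 0}"
  shows "(SUP d\<in>D. ennreal (infnorm (C *v d) / infnorm (d vdiv (\<Phi> *v w))))
    = ennreal (mat_infnorm (C ** \<Phi> ** diag_mat w))"
proof -
  define B where "B = C ** \<Phi> ** diag_mat w"
  define T where "T = {j. w $ j \<noteq> 0}"
  define U where "U = {u :: real^'k. u \<noteq> 0 \<and> (\<forall>j. j \<notin> T \<longrightarrow> u $ j = 0)}"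
  define e where "e u = \<Phi> *v (diag_mat w *v u)" for u
  have norm: "infnorm (e u vdiv (\<Phi> *v w)) = infnorm u" if "\<forall>j. j \<notin> T \<longrightarrow> u $ j = 0" for u
  proof -
    have "e u vdiv (\<Phi> *v w) = \<Phi> *v ((diag_mat w *v u) vdiv w)"
      using S by (simp add: e_def structure_matrix_def diag_mat_mult_vec)
    \<comment> \<open>On \<open>T\<close> the division undoes the multiplication; off
      \<open>T\<close> it leaves the entry 0, which is also the entry of \<open>u\<close>.\<close>
    also have "(diag_mat w *v u) vdiv w = u"
      using that by (auto simp: vec_eq_iff vdiv_component diag_mat_mult_vec ddag_def T_def)
    finally show ?thesis using S by (simp add: structure_matrix_def)
  qed
  have "D = e ` U"
  proof (intro equalityI subsetI)
    fix d assume "d \<in> D"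
    then obtain v where d: "d = \<Phi> *v v" and z: "\<forall>i. (\<Phi> *v w) $ i = 0 \<longrightarrow> (\<Phi> *v v) $ i = 0"
      and nz: "infnorm (d vdiv (\<Phi> *v w)) \<noteq> 0" by (auto simp: D_def)
    have v: "\<forall>j. w $ j = 0 \<longrightarrow> v $ j = 0"
      using structure_matrix_zero_pattern[OF S] z by blast
    \<comment> \<open>The relative perturbation of the parameters. Multiplying by \<open>w\<close>
      recovers \<open>v\<close>, since \<open>v\<close> is 0 wherever \<open>w\<close> is.\<close>
    define u where "u = v vdiv w"
    have u: "\<forall>j. j \<notin> T \<longrightarrow> u $ j = 0" using v by (auto simp: u_def T_def vdiv_component)
    have "diag_mat w *v u = v"
      using v by (auto simp: vec_eq_iff u_def vdiv_component diag_mat_mult_vec ddag_def)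
    then have "d = e u" by (simp add: d e_def)
    moreover have "u \<noteq> 0"
      using norm[OF u] nz \<open>d = e u\<close> by (auto simp: infnorm_eq_0)
    ultimately show "d \<in> e ` U" using u by (auto simp: U_def)
  next
    fix d assume "d \<in> e ` U"
    then obtain u where d: "d = e u" and u: "u \<noteq> 0" "\<forall>j. j \<notin> T \<longrightarrow> u $ j = 0"
      by (auto simp: U_def)
    have "\<forall>i. (\<Phi> *v w) $ i = 0 \<longrightarrow> e u $ i = 0"
      unfolding e_def structure_matrix_zero_pattern[OF S] by (simp add: diag_mat_mult_vec)
    then show "d \<in> D"
      using u norm[OF u(2)] infnorm_pos_lt[of u] unfolding D_def d by (auto simp: e_def)
  qed
  then have "(SUP d\<in>D. ennreal (infnorm (C *v d) / infnorm (d vdiv (\<Phi> *v w))))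
      = (SUP u\<in>U. ennreal (infnorm (C *v e u) / infnorm (e u vdiv (\<Phi> *v w))))"
    by (simp add: image_image)
  also have "\<dots> = (SUP u\<in>U. ennreal (infnorm (B *v u) / infnorm u))"
    by (intro SUP_cong refl)
       (simp add: U_def norm, simp add: B_def e_def matrix_vector_mul_assoc matrix_mul_assoc)
  also have "\<dots> = ennreal (mat_infnorm B)"
    unfolding U_def
    \<comment> \<open>Columns of \<open>B\<close> off \<open>T\<close> carry the factor
      \<open>w $ j = 0\<close>.\<close>
    by (rule mat_infnorm_Sup_supported) (simp add: B_def T_def diag_mat_mult_right)
  finally show ?thesis by (simp add: B_def)
qed

section \<open>The derivative in matrix form\<close>

lemma kron_row_mult_vectorize: "kron_row v Q *v vectorize X = Q *v (X *v v)"
proof -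
  have "(kron_row v Q *v vectorize X) $ i = (Q *v (X *v v)) $ i" for i
  proof -
    have "(kron_row v Q *v vectorize X) $ i
        = (\<Sum>c\<in>UNIV. v $ fst c * Q $ i $ snd c * X $ snd c $ fst c)"
      by (simp add: kron_row_def kron_def rowvector_def vectorize_def matrix_vector_mult_def)
    also have "\<dots> = (\<Sum>j\<in>UNIV. \<Sum>l\<in>UNIV. v $ j * Q $ i $ l * X $ l $ j)"
      by (simp add: sum.cartesian_product case_prod_unfold flip: UNIV_Times_UNIV)
    also have "\<dots> = (Q *v (X *v v)) $ i"
      by (subst sum.swap) (simp add: matrix_vector_mult_def sum_distrib_left mult_ac)
    finally show ?thesis .
  qed
  then show ?thesis by (simp add: vec_eq_iff)
qed

text \<open>The permutation turns the vectorized \<Delta>A into that of its transpose, so the two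
  Kronecker blocks give the two terms in \<Delta>A and the last block gives the term in
  \<Delta>b.\<close>

lemma frechet_derivative_eq_ils_M:
  assumes "pos_def (ils_gram p A)"
  shows "frechet_derivative (ils_map p L) (at (A, b)) (\<Delta>A, \<Delta>b)
    = ils_M p L A b *v stack (vectorize \<Delta>A) \<Delta>b"
  by (simp add: frechet_derivative_ils_map[OF assms] ils_M_def Let_def row_block_mult_stack
      matrix_vector_mult_diff_rdistrib vec_perm_vectorize kron_row_mult_vectorize
      flip: matrix_vector_mul_assoc)

section \<open>From pairs of perturbations to stacked vectors\<close>

lemma vectorize_surj:
  obtains X where "y = vectorize X"
proof
  show "y = vectorize (\<chi> i j. y $ (j, i))" by (simp add: vec_eq_iff vectorize_def)
qed

lemma vectorize_mdiv: "vectorize (X mdiv Y) = vectorize X vdiv vectorize Y"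
  by (simp add: vec_eq_iff vectorize_def mdiv_def vdiv_component)

text \<open>Stacking carries the admissible pairs onto the set \<open>D\<close> of the abstract
  supremum, and turns both numerator and denominator into those for \<open>C\<close>,
  \<open>\<Phi>\<close> and \<open>w\<close>. Division by \<xi> is absorbed into
  \<open>C\<close>.\<close>

lemma cond_inf_ILS_eq_mat_infnorm:
  fixes A \<Psi> :: "real^'n^'m::{finite,linorder}" and b \<beta> :: "real^'m::{finite,linorder}"
  assumes S1: "S1 = structured_matrices \<Phi>1" "structure_matrix \<Phi>1"
    and S2: "S2 = structured_vectors \<Phi>2" "structure_matrix \<Phi>2"
    and pd: "pos_def (ils_gram p A)"
    and \<Psi>: "vectorize \<Psi> = \<Phi>1 *v \<phi>" and \<beta>: "\<beta> = \<Phi>2 *v \<theta>"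
  shows "cond_inf_ILS p L S1 S2 \<Psi> \<beta> \<xi> A b
    = ennreal (mat_infnorm (ddag_mat \<xi> ** ils_M p L A b ** block_diag \<Phi>1 \<Phi>2
                              ** diag_mat (stack \<phi> \<theta>)))"
proof -
  define \<Phi> where "\<Phi> = block_diag \<Phi>1 \<Phi>2"
  define w where "w = stack \<phi> \<theta>"
  define C where "C = ddag_mat \<xi> ** ils_M p L A b"
  define d where "d = (\<lambda>(\<Delta>A :: real^'n^'m::{finite,linorder}, \<Delta>b :: real^'m::{finite,linorder}). stack (vectorize \<Delta>A) \<Delta>b)"
  define D where "D = {d. (\<exists>v. d = \<Phi> *v v) \<and> (\<forall>i. (\<Phi> *v w) $ i = 0 \<longrightarrow> d $ i = 0)
                    \<and> infnorm (d vdiv (\<Phi> *v w)) \<noteq> 0}"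
  have w: "\<Phi> *v w = stack (vectorize \<Psi>) \<beta>"
    by (simp add: \<Phi>_def w_def block_diag_mult_stack \<Psi> \<beta>)
  have norm: "stack (vectorize (\<Delta>A mdiv \<Psi>)) (\<Delta>b vdiv \<beta>) = d (\<Delta>A, \<Delta>b) vdiv (\<Phi> *v w)" for \<Delta>A \<Delta>b
    by (simp add: d_def w stack_vdiv vectorize_mdiv)
  have C: "(ils_M p L A b *v y) vdiv \<xi> = C *v y" for y
    by (simp add: C_def vdiv_def matrix_vector_mul_assoc)
  have range: "(\<exists>v. d (\<Delta>A, \<Delta>b) = \<Phi> *v v) \<longleftrightarrow> \<Delta>A \<in> S1 \<and> \<Delta>b \<in> S2" for \<Delta>A \<Delta>b
  proof
    assume "\<exists>v. d (\<Delta>A, \<Delta>b) = \<Phi> *v v"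
    then obtain v where v: "d (\<Delta>A, \<Delta>b) = \<Phi> *v v" by blast
    obtain v1 v2 where "v = stack v1 v2" by (rule stack_cases)
    with v show "\<Delta>A \<in> S1 \<and> \<Delta>b \<in> S2"
      by (auto simp: S1 S2 structured_matrices_def structured_vectors_def d_def \<Phi>_def
          block_diag_mult_stack stack_eq_iff)
  next
    assume "\<Delta>A \<in> S1 \<and> \<Delta>b \<in> S2"
    then obtain v1 v2 where "vectorize \<Delta>A = \<Phi>1 *v v1" "\<Delta>b = \<Phi>2 *v v2"
      by (auto simp: S1 S2 structured_matrices_def structured_vectors_def)
    then have "d (\<Delta>A, \<Delta>b) = \<Phi> *v stack v1 v2"
      by (simp add: d_def \<Phi>_def block_diag_mult_stack)
    then show "\<exists>v. d (\<Delta>A, \<Delta>b) = \<Phi> *v v" by blast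
  qed
  have zero: "(\<forall>i. (\<Phi> *v w) $ i = 0 \<longrightarrow> d (\<Delta>A, \<Delta>b) $ i = 0) \<longleftrightarrow>
      (\<forall>i j. \<Psi> $ i $ j = 0 \<longrightarrow> \<Delta>A $ i $ j = 0) \<and> (\<forall>i. \<beta> $ i = 0 \<longrightarrow> \<Delta>b $ i = 0)" for \<Delta>A \<Delta>b
    by (auto simp: w d_def split_sum_all vectorize_def)
  have mem: "(\<Delta>A, \<Delta>b) \<in> struct_perturbations S1 S2 \<Psi> \<beta> \<longleftrightarrow> d (\<Delta>A, \<Delta>b) \<in> D" for \<Delta>A \<Delta>b
    unfolding struct_perturbations_def D_def mem_Collect_eq case_prod_conv range zero norm by blast
  \<comment> \<open>Surjectivity holds because every vector of this index type is a vectorized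
    matrix stacked on a vector.\<close>
  have "d ` struct_perturbations S1 S2 \<Psi> \<beta> = D"
  proof (intro equalityI subsetI)
    fix y assume y: "y \<in> D"
    obtain u v where uv: "y = stack u v" by (rule stack_cases)
    obtain X where "u = vectorize X" by (rule vectorize_surj)
    with uv have "y = d (X, v)" by (simp add: d_def)
    with y mem show "y \<in> d ` struct_perturbations S1 S2 \<Psi> \<beta>" by blast
  qed (use mem in auto)
  moreover have "cond_inf_ILS p L S1 S2 \<Psi> \<beta> \<xi> A b =
      (SUP z \<in> struct_perturbations S1 S2 \<Psi> \<beta>.
         ennreal (infnorm (C *v d z) / infnorm (d z vdiv (\<Phi> *v w))))"
    unfolding cond_inf_ILS_def
    by (intro SUP_cong refl)
       (clarsimp simp: C norm frechet_derivative_eq_ils_M[OF pd], simp add: d_def)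
  ultimately have "cond_inf_ILS p L S1 S2 \<Psi> \<beta> \<xi> A b =
      (SUP y \<in> D. ennreal (infnorm (C *v y) / infnorm (y vdiv (\<Phi> *v w))))"
    by (metis (no_types, lifting) SUP_image comp_def image_cong)
  also have "\<dots> = ennreal (mat_infnorm (C ** \<Phi> ** diag_mat w))"
    unfolding D_def
    by (rule structured_Sup_eq_mat_infnorm)
       (simp add: \<Phi>_def structure_matrix_block_diag[OF S1(2) S2(2)])
  finally show ?thesis by (simp add: C_def \<Phi>_def w_def)
qed

text \<open>In each absolute row sum the diagonal factors come out as absolute values, and
  \<open>ddag\<close> commutes with the absolute value.\<close>

lemma mat_infnorm_ddag_mat_diag_mat:
  "mat_infnorm (ddag_mat \<xi> ** N ** diag_mat w) = infnorm ((mabs N *v vabs w) vdiv vabs \<xi>)"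
proof -
  have "(\<chi> i. \<Sum>j\<in>UNIV. \<bar>(ddag_mat \<xi> ** N ** diag_mat w) $ i $ j\<bar>) = (mabs N *v vabs w) vdiv vabs \<xi>"
    by (simp add: vec_eq_iff vdiv_component matrix_vector_mult_def mabs_def vabs_def ddag_mat_def
        diag_mat_mult_left diag_mat_mult_right abs_mult abs_ddag sum_distrib_left mult_ac)
  then show ?thesis by (simp add: mat_infnorm_eq_infnorm)
qed

text \<open>Serves the mixed condition number, where \<xi> is constant. With \<open>ddag\<close> it
  also covers \<open>c = 0\<close>, where the factor is 1.\<close>

lemma infnorm_vdiv_const:
  assumes "0 \<le> c"
  shows "infnorm (v vdiv vabs (\<chi> i. c)) = ddag c * infnorm v"
proof -
  have "v vdiv vabs (\<chi> i. c) = ddag c *\<^sub>R v"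
    using assms by (simp add: vec_eq_iff vdiv_component vabs_def)
  then show ?thesis using assms by (simp add: infnorm_mul abs_ddag)
qed

theorem theorem4p4:
  fixes A :: "real^'n^'m::{finite,linorder}" and b :: "real^'m::{finite,linorder}" and L :: "real^'k^'n"
    and S1 :: "(real^'n^'m::{finite,linorder}) set" and S2 :: "(real^'m::{finite,linorder}) set"
    and \<Phi>1 :: "real^'k1^('n \<times> 'm)" and \<Phi>2 :: "real^'k2^'m::{finite,linorder}"
    and \<Psi> :: "real^'n^'m::{finite,linorder}" and \<beta> :: "real^'m::{finite,linorder}" and \<xi> :: "real^'k"
    and s1 \<phi> :: "real^'k1" and s2 \<theta> :: "real^'k2"
    and p q :: nat
  assumes "CARD('n) \<le> CARD('m)" and "CARD('k) \<le> CARD('n)"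
    and "p + q = CARD('m)"
    and "subspace S1" and "S1 = structured_matrices \<Phi>1" and "structure_matrix \<Phi>1"
    and "subspace S2" and "S2 = structured_vectors \<Phi>2" and "structure_matrix \<Phi>2"
    and "A \<in> S1" and "vectorize A = \<Phi>1 *v s1"
    and "b \<in> S2" and "b = \<Phi>2 *v s2"
    and "pos_def (ils_gram p A)"
    and "\<Psi> \<in> S1" and "vectorize \<Psi> = \<Phi>1 *v \<phi>"
    and "\<beta> \<in> S2" and "\<beta> = \<Phi>2 *v \<theta>"
  shows "cond_inf_ILS p L S1 S2 \<Psi> \<beta> \<xi> A b
           = ennreal (mat_infnorm (ddag_mat \<xi> ** ils_M p L A b ** block_diag \<Phi>1 \<Phi>2
                                     ** diag_mat (stack \<phi> \<theta>)))
       \<and> cond_inf_ILS p L S1 S2 \<Psi> \<beta> \<xi> A b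
           = ennreal (infnorm ((mabs (ils_M p L A b ** block_diag \<Phi>1 \<Phi>2) *v vabs (stack \<phi> \<theta>))
                                 vdiv vabs \<xi>))
       \<and> cond_mixed_ILS p L S1 S2 A b
           = ennreal (ddag (infnorm (transpose L *v ils_sol p A b))
                * infnorm (mabs (ils_M p L A b ** block_diag \<Phi>1 \<Phi>2) *v vabs (stack s1 s2)))
       \<and> cond_comp_ILS p L S1 S2 A b
           = ennreal (infnorm ((mabs (ils_M p L A b ** block_diag \<Phi>1 \<Phi>2) *v vabs (stack s1 s2))
                                 vdiv vabs (transpose L *v ils_sol p A b)))"
proof -
  note cond = cond_inf_ILS_eq_mat_infnorm[OF assms(5,6,8,9,14)]
  let ?N = "ils_M p L A b ** block_diag \<Phi>1 \<Phi>2"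
  have entrywise: "mat_infnorm (ddag_mat \<zeta> ** ils_M p L A b ** block_diag \<Phi>1 \<Phi>2 ** diag_mat w)
      = infnorm ((mabs ?N *v vabs w) vdiv vabs \<zeta>)" for \<zeta> w
    using mat_infnorm_ddag_mat_diag_mat[of \<zeta> ?N w] by (simp add: matrix_mul_assoc)
  \<comment> \<open>With \<open>\<zeta>\<close> left free, this one instance serves both the mixed
    and the componentwise number.\<close>
  have A: "cond_inf_ILS p L S1 S2 A b \<zeta> A b
      = ennreal (infnorm ((mabs ?N *v vabs (stack s1 s2)) vdiv vabs \<zeta>))" for \<zeta>
    unfolding cond[OF assms(11,13)] entrywise by (rule refl)
  show ?thesis
    by (simp add: cond[OF assms(16,18)] entrywise cond_mixed_ILS_def cond_comp_ILS_def A infnorm_vdiv_const infnorm_pos_le)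
qed

end
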